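(* Let $\ell\ge3$. Every L-partition is a node of the crystal $B(\Lambda_0)^L$.
   Context: Young diagrams in English notation; $(a,b)$ is the box in row $a$, column $b$, residue $b-a\bmod\ell$. For a box $(i,j)$ of $\lambda$: $\mathrm{arm}(i,j)=\lambda_i-j$, $\mathrm{leg}(i,j)=\lambda'_j-i$, hook length $h^\lambda_{(i,j)}=\mathrm{arm}(i,j)+\mathrm{leg}(i,j)+1$. An L-partition is a partition having no box $(i,j)$ with $\ell\mid h^\lambda_{(i,j)}$, $\mathrm{arm}(i,j)<(\ell-1)\,\mathrm{leg}(i,j)$ and $\mathrm{leg}(i,j)<(\ell-1)\,\mathrm{arm}(i,j)$ (equivalently, no box with $\ell\mid h^\lambda_{(i,j)}$ and $h^\lambda_{(i,j)}/\ell\le\min\{\mathrm{arm}(i,j),\mathrm{leg}(i,j)\}$). Removable (resp. addable) $i$-box: a box in $\lambda$ (resp. position not in $\lambda$) of residue $i$ whose removal (resp. addition) yields a partition. The ladder of $(a,b)$ is the set of positions $(c,d)$, $c,d\ge1$, with $c+(\ell-1)d=a+(\ell-1)b$; ladders are ordered left to right by increasing $c+(\ell-1)d$, within a ladder top to bottom by increasing row index. The ladder $i$-signature writes $+$ for each addable $i$-box and $-$ for each removable $i$-box, reading ladders left to right and each ladder top to bottom; repeatedly deleting adjacent "$-+$" gives $+\cdots+-\cdots-$; the box of the rightmost remaining $+$ is the ladder cogood $i$-box and $\widehat f_i\lambda$ is $\lambda$ with it added ($0$ if none). The nodes of $B(\Lambda_0)^L$ are the partitions obtainable from the empty partition by finite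 sequences of the $\widehat f_i$, $0\le i<\ell$. *)

theory Defs
  imports Main
begin

text \<open>
  A partition is identified with its Young diagram in English notation: the finite set of its
  boxes \<open>(a, b)\<close> (row \<open>a\<close>, column \<open>b\<close>, both counted from 1), which is closed under moving up
  and to the left. The row length \<open>\<lambda>\<^sub>i\<close> and the column length \<open>\<lambda>'\<^sub>j\<close> are recovered by counting.
\<close>

type_synonym box = "nat \<times> nat"

definition is_partition :: "box set \<Rightarrow> bool" where
  "is_partition lam \<longleftrightarrow> finite lam \<and>
     (\<forall>(a, b) \<in> lam. 1 \<le> a \<and> 1 \<le> b \<and>
        (\<forall>c d. 1 \<le> c \<and> c \<le> a \<and> 1 \<le> d \<and> d \<le> b \<longrightarrow> (c, d) \<in> lam))"

definition row_length :: "box set \<Rightarrow> nat \<Rightarrow> nat" where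
  "row_length lam i = card {j. (i, j) \<in> lam}"

definition col_length :: "box set \<Rightarrow> nat \<Rightarrow> nat" where
  "col_length lam j = card {i. (i, j) \<in> lam}"

text \<open>Only used for boxes of the diagram, where the subtractions do not truncate.\<close>

definition arm :: "box set \<Rightarrow> nat \<Rightarrow> nat \<Rightarrow> nat" where
  "arm lam i j = row_length lam i - j"

definition leg :: "box set \<Rightarrow> nat \<Rightarrow> nat \<Rightarrow> nat" where
  "leg lam i j = col_length lam j - i"

definition hook :: "box set \<Rightarrow> nat \<Rightarrow> nat \<Rightarrow> nat" where
  "hook lam i j = arm lam i j + leg lam i j + 1"

definition L_partition :: "nat \<Rightarrow> box set \<Rightarrow> bool" where
  "L_partition l lam \<longleftrightarrow> is_partition lam \<and>
     \<not> (\<exists>(i, j) \<in> lam. l dvd hook lam i j \<and>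
          arm lam i j < (l - 1) * leg lam i j \<and>
          leg lam i j < (l - 1) * arm lam i j)"

fun residue :: "nat \<Rightarrow> box \<Rightarrow> nat" where
  "residue l (a, b) = nat ((int b - int a) mod int l)"

definition addable :: "nat \<Rightarrow> nat \<Rightarrow> box set \<Rightarrow> box set" where
  "addable l i lam = {x. x \<notin> lam \<and> residue l x = i \<and> is_partition (insert x lam)}"

definition removable :: "nat \<Rightarrow> nat \<Rightarrow> box set \<Rightarrow> box set" where
  "removable l i lam = {x. x \<in> lam \<and> residue l x = i \<and> is_partition (lam - {x})}"

text \<open>
  The ladder of \<open>(a, b)\<close> is the fibre of \<open>ladder_index\<close> through \<open>(a, b)\<close>. The reading order
  goes through the ladders by increasing index, and through each ladder by increasing row.
\<close>

fun ladder_index :: "nat \<Rightarrow> box \<Rightarrow> nat" where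
  "ladder_index l (c, d) = c + (l - 1) * d"

definition ladder_before :: "nat \<Rightarrow> box \<Rightarrow> box \<Rightarrow> bool" where
  "ladder_before l x y \<longleftrightarrow> ladder_index l x < ladder_index l y \<or>
     (ladder_index l x = ladder_index l y \<and> fst x < fst y)"

datatype sign = PlusSign | MinusSign

text \<open>
  Each sign of a signature carries the box that it comes from. For \<open>l \<ge> 2\<close> there is exactly one
  list as in the definition of \<open>ladder_signature\<close>; see \<open>ladder_signature_ex1\<close> below.
\<close>

type_synonym signature = "(sign \<times> box) list"

definition ladder_signature :: "nat \<Rightarrow> nat \<Rightarrow> box set \<Rightarrow> signature" where
  "ladder_signature l i lam =
     (THE w. sorted_wrt (\<lambda>p q. ladder_before l (snd p) (snd q)) w \<and>
        set w = {PlusSign} \<times> addable l i lam \<union> {MinusSign} \<times> removable l i lam)"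

inductive cancel_step :: "signature \<Rightarrow> signature \<Rightarrow> bool" where
  "cancel_step (u @ (MinusSign, x) # (PlusSign, y) # v) (u @ v)"

definition reduces_to :: "signature \<Rightarrow> signature \<Rightarrow> bool" where
  "reduces_to w w' \<longleftrightarrow> cancel_step\<^sup>*\<^sup>* w w' \<and> \<not> (\<exists>w''. cancel_step w' w'')"

definition ladder_cogood :: "nat \<Rightarrow> nat \<Rightarrow> box set \<Rightarrow> box \<Rightarrow> bool" where
  "ladder_cogood l i lam x \<longleftrightarrow>
     (\<exists>u v. reduces_to (ladder_signature l i lam) (u @ (PlusSign, x) # v) \<and>
        PlusSign \<notin> fst ` set v)"

text \<open>
  The value \<open>0\<close> of the operator is \<open>None\<close>. There is at most one ladder cogood box; see
  \<open>ladder_cogood_unique\<close> below.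
\<close>

definition f_hat :: "nat \<Rightarrow> nat \<Rightarrow> box set \<Rightarrow> box set option" where
  "f_hat l i lam =
     (if \<exists>x. ladder_cogood l i lam x
      then Some (insert (THE x. ladder_cogood l i lam x) lam) else None)"

inductive_set crystal_nodes :: "nat \<Rightarrow> box set set" for l :: nat where
  empty: "{} \<in> crystal_nodes l"
| step: "lam \<in> crystal_nodes l \<Longrightarrow> i < l \<Longrightarrow> f_hat l i lam = Some mu \<Longrightarrow> mu \<in> crystal_nodes l"

subsection \<open>The signature and the cogood box are well defined\<close>

lemma sorted_wrt_set_ex1:
  assumes "finite A"
    and irrefl: "\<And>x. \<not> R x x"
    and trans: "\<And>x y z. R x y \<Longrightarrow> R y z \<Longrightarrow> R x z"
    and total: "\<And>x y. x \<in> A \<Longrightarrow> y \<in> A \<Longrightarrow> x \<noteq> y \<Longrightarrow> R x y \<or> R y x"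
  shows "\<exists>!w. sorted_wrt R w \<and> set w = A"
proof -
  have "\<exists>w. sorted_wrt R w \<and> set w = A"
    using assms(1) total
  proof (induction A rule: finite_induct)
    case empty
    then show ?case by simp
  next
    case (insert x A)
    then obtain w where w: "sorted_wrt R w" "set w = A" by blast
    let ?w = "filter (\<lambda>y. R y x) w @ x # filter (\<lambda>y. R x y) w"
    have "sorted_wrt R ?w"
      using w(1) by (auto simp: sorted_wrt_append sorted_wrt_filter intro: trans)
    moreover have "set ?w = insert x A"
      using w(2) insert.hyps(2) insert.prems by auto
    ultimately show ?case by blast
  qed
  moreover have "v = w" if "sorted_wrt R v" "sorted_wrt R w" "set v = set w" for v w
    using that
  proof (induction v arbitrary: w)
    case Nil
    then show ?case by simp
  next
    case (Cons a v)
    then obtain b w' where w: "w = b # w'" by (cases w) auto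
    have ab: "a = b"
    proof (rule ccontr)
      assume "a \<noteq> b"
      then have "a \<in> set w'" "b \<in> set v" using Cons.prems(3) w by auto
      then have "R b a" "R a b" using Cons.prems w by auto
      then show False using trans irrefl by blast
    qed
    have "a \<notin> set v" "b \<notin> set w'" using Cons.prems w irrefl by auto
    then have "set v = set w'" using Cons.prems(3) w ab by auto
    then show ?case using Cons w ab by auto
  qed
  ultimately show ?thesis by blast
qed

lemma finite_addable:
  assumes "is_partition lam"
  shows "finite (addable l i lam)"
proof (rule finite_subset)
  let ?S = "{(1, 1)} \<union> (\<lambda>(a, b). (Suc a, b)) ` lam \<union> (\<lambda>(a, b). (a, Suc b)) ` lam"
  show "finite ?S" using assms by (simp add: is_partition_def)
  show "addable l i lam \<subseteq> ?S"
  proof (rule subsetI)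
    fix x assume x: "x \<in> addable l i lam"
    obtain a b where ab: "x = (a, b)" by (cases x)
    have pos: "1 \<le> a" "1 \<le> b"
      and closed: "\<And>c d. 1 \<le> c \<Longrightarrow> c \<le> a \<Longrightarrow> 1 \<le> d \<Longrightarrow> d \<le> b \<Longrightarrow> (c, d) \<in> insert (a, b) lam"
      using x unfolding ab addable_def is_partition_def by auto
    consider "a = 1" "b = 1" | "2 \<le> a" | "2 \<le> b" using pos by linarith
    then show "x \<in> ?S"
    proof cases
      case 2
      then have "(a - 1, b) \<in> lam" using closed[of "a - 1" b] pos by force
      then have "(\<lambda>(a, b). (Suc a, b)) (a - 1, b) \<in> (\<lambda>(a, b). (Suc a, b)) ` lam"
        by (rule imageI)
      then show ?thesis using 2 ab by simp
    next
      case 3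
      then have "(a, b - 1) \<in> lam" using closed[of a "b - 1"] pos by force
      then have "(\<lambda>(a, b). (a, Suc b)) (a, b - 1) \<in> (\<lambda>(a, b). (a, Suc b)) ` lam"
        by (rule imageI)
      then show ?thesis using 3 ab by simp
    qed (use ab in simp)
  qed
qed

lemma ladder_before_total:
  assumes "2 \<le> l" "x \<noteq> y"
  shows "ladder_before l x y \<or> ladder_before l y x"
proof -
  obtain a b c d where xy: "x = (a, b)" "y = (c, d)" by (cases x; cases y)
  show ?thesis
  proof (cases "a = c")
    case True
    then show ?thesis using assms xy by (auto simp: ladder_before_def)
  next
    case False
    then show ?thesis using xy by (auto simp: ladder_before_def)
  qed
qed

lemma ladder_signature_ex1:
  assumes "2 \<le> l" "is_partition lam"
  shows "\<exists>!w. sorted_wrt (\<lambda>p q. ladder_before l (snd p) (snd q)) w \<and>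
    set w = {PlusSign} \<times> addable l i lam \<union> {MinusSign} \<times> removable l i lam"
proof (rule sorted_wrt_set_ex1)
  have "finite (removable l i lam)"
    using assms(2) by (auto simp: removable_def is_partition_def)
  then show "finite ({PlusSign} \<times> addable l i lam \<union> {MinusSign} \<times> removable l i lam)"
    using finite_addable[OF assms(2)] by blast
next
  fix p q
  assume "p \<in> {PlusSign} \<times> addable l i lam \<union> {MinusSign} \<times> removable l i lam"
    "q \<in> {PlusSign} \<times> addable l i lam \<union> {MinusSign} \<times> removable l i lam" "p \<noteq> q"
  then have "snd p \<noteq> snd q" by (auto simp: addable_def removable_def)
  then show "ladder_before l (snd p) (snd q) \<or> ladder_before l (snd q) (snd p)"
    by (rule ladder_before_total[OF assms(1)])
qed (auto simp: ladder_before_def)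

text \<open>The reduced word, computed from the right.\<close>

fun cancel_cons :: "sign \<times> box \<Rightarrow> signature \<Rightarrow> signature" where
  "cancel_cons (MinusSign, x) ((PlusSign, y) # w) = w"
| "cancel_cons p w = p # w"

lemma reduces_to_unique:
  assumes "reduces_to w w1" "reduces_to w w2"
  shows "w1 = w2"
proof -
  let ?nf = "\<lambda>w. foldr cancel_cons w []"
  have "?nf v = ?nf w" if "cancel_step\<^sup>*\<^sup>* v w" for v w
    using that
  proof induction
    case (step y z)
    have two: "cancel_cons (MinusSign, x) (cancel_cons (PlusSign, y) w) = w" for x y w
      by simp
    show ?case using step.IH step.hyps(2) by (auto elim!: cancel_step.cases simp: two)
  qed simp
  moreover have "?nf w = w" if "\<not> (\<exists>w'. cancel_step w w')" for w
    using that
  proof (induction w)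
    case (Cons p w)
    have "\<not> (\<exists>w'. cancel_step w w')"
    proof
      assume "\<exists>w'. cancel_step w w'"
      then obtain w' where "cancel_step w w'" by blast
      then have "cancel_step (p # w) (p # w')"
        by cases (metis cancel_step.intros append_Cons)
      then show False using Cons.prems by blast
    qed
    then have "?nf (p # w) = cancel_cons p w" using Cons.IH by simp
    also have "\<dots> = p # w"
    proof (rule ccontr)
      assume "cancel_cons p w \<noteq> p # w"
      then obtain x y v where "p = (MinusSign, x)" "w = (PlusSign, y) # v"
        by (cases "(p, w)" rule: cancel_cons.cases) auto
      then show False using Cons.prems cancel_step.intros[of "[]" x y v] by auto
    qed
    finally show ?case .
  qed simp
  ultimately show ?thesis using assms unfolding reduces_to_def by metis
qed

lemma ladder_cogood_unique:
  assumes "ladder_cogood l i lam x" "ladder_cogood l i lam y"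
  shows "x = y"
proof -
  obtain u v where 1: "reduces_to (ladder_signature l i lam) (u @ (PlusSign, x) # v)"
    "PlusSign \<notin> fst ` set v"
    using assms(1) unfolding ladder_cogood_def by blast
  obtain u' v' where 2: "reduces_to (ladder_signature l i lam) (u' @ (PlusSign, y) # v')"
    "PlusSign \<notin> fst ` set v'"
    using assms(2) unfolding ladder_cogood_def by blast
  have "u @ (PlusSign, x) # v = u' @ (PlusSign, y) # v'"
    using 1(1) 2(1) by (rule reduces_to_unique)
  with 1(2) 2(2) show ?thesis
    by (force simp: append_eq_append_conv2 append_eq_Cons_conv Cons_eq_append_conv)
qed

end

theory Submission
  imports Defs
begin

text \<open>
  L-partitions are not stable under removing the ladder good box (for \<open>l = 4\<close>, consider
  \<open>(3, 1, 1)\<close>), so the induction runs over the larger class of partitions without a box of hook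
  length \<open>l * arm\<close>. In such a partition the last box in ladder order is removable and its sign
  is never cancelled, so there is a ladder good box. If its removal created a box of hook length
  \<open>l * arm\<close>, the other end of that hook would be a removable box of the same residue, read
  earlier and hence cancelled by an addable box in between; every position of that addable
  box already yields a box of hook length \<open>l * arm\<close> before the removal.
\<close>

subsection \<open>Partitions, residues and ladders\<close>

lemma is_partition_pos:
  assumes "is_partition lam" "(a, b) \<in> lam"
  shows "1 \<le> a" "1 \<le> b"
  using assms unfolding is_partition_def by auto

lemma is_partition_down:
  assumes "is_partition lam" "(a, b) \<in> lam" "1 \<le> c" "c \<le> a" "1 \<le> d" "d \<le> b"
  shows "(c, d) \<in> lam"
  using assms unfolding is_partition_def by blast

section \<open>Row and column lengths read off from end boxes\<close>

lemma initial_segment_eq_atLeastAtMost: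
  fixes S :: "nat set"
  assumes "finite S" "\<And>j. j \<in> S \<Longrightarrow> 1 \<le> j"
    and "\<And>j k. j \<in> S \<Longrightarrow> 1 \<le> k \<Longrightarrow> k \<le> j \<Longrightarrow> k \<in> S"
    and "n \<in> S" "Suc n \<notin> S"
  shows "S = {1..n}"
proof (rule set_eqI)
  fix j
  have "j \<le> n" if "j \<in> S"
    using assms(3)[OF that, of "Suc n"] assms(5) by fastforce
  then show "j \<in> S \<longleftrightarrow> j \<in> {1..n}" using assms(2)[of j] assms(3)[OF assms(4), of j] by auto
qed

lemma row_length_eq:
  assumes "is_partition lam" "(a, f) \<in> lam" "(a, Suc f) \<notin> lam"
  shows "row_length lam a = f"
proof -
  have "{j. (a, j) \<in> lam} \<subseteq> snd ` lam" by force
  then have "finite {j. (a, j) \<in> lam}"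
    using assms(1) by (auto simp: is_partition_def intro: finite_subset)
  moreover have "1 \<le> a" using is_partition_pos[OF assms(1,2)] by simp
  ultimately have "{j. (a, j) \<in> lam} = {1..f}"
    using assms is_partition_pos(2)[OF assms(1)] is_partition_down[OF assms(1), of a _ a]
    by (intro initial_segment_eq_atLeastAtMost) auto
  then show ?thesis by (simp add: row_length_def)
qed

lemma col_length_eq:
  assumes "is_partition lam" "(e, d) \<in> lam" "(Suc e, d) \<notin> lam"
  shows "col_length lam d = e"
proof -
  have "{i. (i, d) \<in> lam} \<subseteq> fst ` lam" by force
  then have "finite {i. (i, d) \<in> lam}"
    using assms(1) by (auto simp: is_partition_def intro: finite_subset)
  moreover have "1 \<le> d" using is_partition_pos[OF assms(1,2)] by simp
  ultimately have "{i. (i, d) \<in> lam} = {1..e}"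
    using assms is_partition_pos(1)[OF assms(1)] is_partition_down[OF assms(1), of _ d _ d]
    by (intro initial_segment_eq_atLeastAtMost) auto
  then show ?thesis by (simp add: col_length_def)
qed

section \<open>Corners of a diagram\<close>

lemma is_partition_remove_iff:
  assumes "is_partition lam" "(a, b) \<in> lam"
  shows "is_partition (lam - {(a, b)}) \<longleftrightarrow> (Suc a, b) \<notin> lam \<and> (a, Suc b) \<notin> lam"
proof
  assume mu: "is_partition (lam - {(a, b)})"
  show "(Suc a, b) \<notin> lam \<and> (a, Suc b) \<notin> lam"
    using is_partition_down[OF mu, of "Suc a" b a b] is_partition_down[OF mu, of a "Suc b" a b]
      is_partition_pos[OF assms] by auto
next
  assume corner: "(Suc a, b) \<notin> lam \<and> (a, Suc b) \<notin> lam"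
  have pos: "1 \<le> a" "1 \<le> b" using is_partition_pos[OF assms] by auto
  have "\<not> (a \<le> r \<and> b \<le> s)" if "(r, s) \<in> lam" "(r, s) \<noteq> (a, b)" for r s
  proof
    assume le: "a \<le> r \<and> b \<le> s"
    then consider "Suc a \<le> r" | "Suc b \<le> s" using \<open>(r, s) \<noteq> (a, b)\<close> by fastforce
    then show False
      using is_partition_down[OF assms(1) \<open>(r, s) \<in> lam\<close>] le corner pos by cases auto
  qed
  then show "is_partition (lam - {(a, b)})"
    using assms(1) unfolding is_partition_def by blast
qed

lemma is_partition_insert_iff:
  assumes "is_partition lam" "(a, b) \<notin> lam"
  shows "is_partition (insert (a, b) lam) \<longleftrightarrow>
    1 \<le> a \<and> 1 \<le> b \<and> (a = 1 \<or> (a - 1, b) \<in> lam) \<and> (b = 1 \<or> (a, b - 1) \<in> lam)"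
proof
  assume mu: "is_partition (insert (a, b) lam)"
  have pos: "1 \<le> a" "1 \<le> b" using is_partition_pos[OF mu] by auto
  show "1 \<le> a \<and> 1 \<le> b \<and> (a = 1 \<or> (a - 1, b) \<in> lam) \<and> (b = 1 \<or> (a, b - 1) \<in> lam)"
    using is_partition_down[OF mu, of a b "a - 1" b] is_partition_down[OF mu, of a b a "b - 1"]
      pos by (cases a; cases b) (auto simp: Suc_le_eq)
next
  assume corner: "1 \<le> a \<and> 1 \<le> b \<and> (a = 1 \<or> (a - 1, b) \<in> lam) \<and> (b = 1 \<or> (a, b - 1) \<in> lam)"
  have "(c, d) \<in> lam" if cd: "1 \<le> c" "c \<le> a" "1 \<le> d" "d \<le> b" "(c, d) \<noteq> (a, b)" for c d
  proof -
    consider "c \<le> a - 1" | "d \<le> b - 1" using cd by fastforce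
    then show ?thesis
    proof cases
      case 1
      then have "(a - 1, b) \<in> lam" using cd corner by auto
      then show ?thesis using is_partition_down[OF assms(1)] 1 cd by blast
    next
      case 2
      then have "(a, b - 1) \<in> lam" using cd corner by auto
      then show ?thesis using is_partition_down[OF assms(1)] 2 cd by blast
    qed
  qed
  then show "is_partition (insert (a, b) lam)"
    using assms(1) corner unfolding is_partition_def by auto
qed

lemma removable_iff:
  assumes "is_partition lam"
  shows "(a, b) \<in> removable l i lam \<longleftrightarrow>
    (a, b) \<in> lam \<and> residue l (a, b) = i \<and> (Suc a, b) \<notin> lam \<and> (a, Suc b) \<notin> lam"
  using is_partition_remove_iff[OF assms] by (auto simp: removable_def)

lemma addable_iff:
  assumes "is_partition lam"
  shows "(a, b) \<in> addable l i lam \<longleftrightarrow>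
    (a, b) \<notin> lam \<and> residue l (a, b) = i \<and> 1 \<le> a \<and> 1 \<le> b \<and>
    (a = 1 \<or> (a - 1, b) \<in> lam) \<and> (b = 1 \<or> (a, b - 1) \<in> lam)"
  using is_partition_insert_iff[OF assms] by (auto simp: addable_def)

text \<open>The index of \<open>(a, b)\<close> is \<open>l * b - (b - a)\<close>, hence modulo
  \<open>l\<close> the negative of the content. In particular all boxes of a ladder share one
  residue.\<close>

lemma residue_eq_iff:
  assumes "1 \<le> l"
  shows "residue l x = residue l y \<longleftrightarrow> ladder_index l x mod l = ladder_index l y mod l"
proof -
  obtain a b c d where xy: "x = (a, b)" "y = (c, d)" by (cases x; cases y)
  have idx: "int (ladder_index l (a, b)) = int l * int b - (int b - int a)" for a b
    using assms by (cases l) (auto simp: algebra_simps)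
  have "residue l x = residue l y \<longleftrightarrow> (int b - int a) mod int l = (int d - int c) mod int l"
    using assms xy by (simp add: nat_eq_iff)
  also have "\<dots> \<longleftrightarrow> int l dvd (int b - int a) - (int d - int c)"
    by (rule mod_eq_dvd_iff)
  also have "\<dots> \<longleftrightarrow> int l dvd int l * (int b - int d) - ((int b - int a) - (int d - int c))"
    by (rule dvd_diff_right_iff[symmetric]) simp
  also have "\<dots> \<longleftrightarrow> int l dvd int (ladder_index l x) - int (ladder_index l y)"
    unfolding xy idx by (simp add: algebra_simps)
  also have "\<dots> \<longleftrightarrow> int (ladder_index l x) mod int l = int (ladder_index l y) mod int l"
    by (rule mod_eq_dvd_iff[symmetric])
  also have "\<dots> \<longleftrightarrow> ladder_index l x mod l = ladder_index l y mod l"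
    by (metis of_nat_eq_iff of_nat_mod)
  finally show ?thesis .
qed

lemma residue_eq_less_imp_add_le:
  assumes "1 \<le> l" "residue l x = residue l y" "ladder_index l x < ladder_index l y"
  shows "ladder_index l x + l \<le> ladder_index l y"
proof -
  have "l dvd ladder_index l y - ladder_index l x"
    using assms residue_eq_iff[OF assms(1)] by (metis mod_eq_dvd_iff_nat less_imp_le)
  then have "l \<le> ladder_index l y - ladder_index l x"
    using assms(3) by (intro dvd_imp_le) auto
  then show ?thesis using assms(3) by linarith
qed

lemma residue_less_bound:
  assumes "1 \<le> l"
  shows "residue l x < l"
  using assms by (cases x) (simp add: nat_less_iff)

text \<open>One step down raises the ladder index by 1, one step right by \<open>l - 1\<close>; both
  are too small for the residue to recur.\<close>

lemma residue_below_neq: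
  assumes "2 \<le> l"
  shows "residue l (Suc a, b) \<noteq> residue l (a, b)"
  using residue_eq_less_imp_add_le[of l "(a, b)" "(Suc a, b)"] assms by auto

lemma residue_right_neq:
  assumes "2 \<le> l"
  shows "residue l (a, Suc b) \<noteq> residue l (a, b)"
  using residue_eq_less_imp_add_le[of l "(a, b)" "(a, Suc b)"] assms
  by (cases l) auto

subsection \<open>Cancellation of signs\<close>

lemma cancel_steps_context:
  assumes "cancel_step\<^sup>*\<^sup>* w w'"
  shows "cancel_step\<^sup>*\<^sup>* (p @ w @ q) (p @ w' @ q)"
  using assms
proof induction
  case (step y z)
  from step.hyps(2) have "cancel_step (p @ y @ q) (p @ z @ q)"
  proof cases
    case (1 u x y v)
    then show ?thesis using cancel_step.intros[of "p @ u" x y "v @ q"] by simp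
  qed
  with step.IH show ?case by (rule rtranclp.rtrancl_into_rtrancl)
qed simp

text \<open>A word in a single sign contains no adjacent minus-plus pair, so the witness is
  automatically fully reduced. The empty word counts for both signs.\<close>

definition cancels_to_sign :: "sign \<Rightarrow> signature \<Rightarrow> bool" where
  "cancels_to_sign s w \<longleftrightarrow> (\<exists>w'. cancel_step\<^sup>*\<^sup>* w w' \<and> fst ` set w' \<subseteq> {s})"

lemma cancels_to_sign_Nil: "cancels_to_sign s []"
  unfolding cancels_to_sign_def by (rule exI[of _ "[]"]) simp

lemma cancels_to_sign_steps:
  assumes "cancel_step\<^sup>*\<^sup>* w w'" "cancels_to_sign s w'"
  shows "cancels_to_sign s w"
  using assms rtranclp_trans unfolding cancels_to_sign_def by fast

lemma cancels_to_sign_snoc: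
  assumes "cancels_to_sign s w"
  shows "cancels_to_sign s (w @ [(s, z)])"
proof -
  obtain w' where w': "cancel_step\<^sup>*\<^sup>* w w'" "fst ` set w' \<subseteq> {s}"
    using assms unfolding cancels_to_sign_def by blast
  have "cancel_step\<^sup>*\<^sup>* (w @ [(s, z)]) (w' @ [(s, z)])"
    using cancel_steps_context[OF w'(1), of "[]" "[(s, z)]"] by simp
  moreover have "fst ` set (w' @ [(s, z)]) \<subseteq> {s}" using w'(2) by auto
  ultimately show ?thesis unfolding cancels_to_sign_def by blast
qed

text \<open>The reduced word consists of pluses followed by minuses. If some minus survives, the
  leftmost survivor is the good one: only pluses survive before it and only minuses after
  it.\<close>

lemma cancels_to_plus_or_good_minus:
  "cancels_to_sign PlusSign w \<or>
   (\<exists>u x v. w = u @ (MinusSign, x) # v \<and>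
      cancels_to_sign PlusSign u \<and> cancels_to_sign MinusSign v)"
proof (induction w rule: rev_induct)
  case Nil
  show ?case by (simp add: cancels_to_sign_Nil)
next
  case (snoc p w)
  obtain s z where p: "p = (s, z)" by (cases p)
  from snoc.IH consider "cancels_to_sign PlusSign w"
    | u x v where "w = u @ (MinusSign, x) # v"
      "cancels_to_sign PlusSign u" "cancels_to_sign MinusSign v"
    by blast
  then show ?case
  proof cases
    case 1
    then show ?thesis
      using p cancels_to_sign_snoc[of PlusSign w z] cancels_to_sign_Nil[of MinusSign]
      by (cases s; blast)
  next
    case (2 u x v)
    have wp: "w @ [p] = u @ (MinusSign, x) # (v @ [p])" using 2(1) by simp
    show ?thesis
    proof (cases s)
      case MinusSign
      then show ?thesis using wp 2(2) cancels_to_sign_snoc[OF 2(3), of z] p by blast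
    next
      case PlusSign
      obtain v' where v': "cancel_step\<^sup>*\<^sup>* v v'" "fst ` set v' \<subseteq> {MinusSign}"
        using 2(3) unfolding cancels_to_sign_def by blast
      have vp: "cancel_step\<^sup>*\<^sup>* (v @ [p]) (v' @ [p])"
        using cancel_steps_context[OF v'(1), of "[]" "[p]"] by simp
      \<comment> \<open>The new plus deletes the last surviving minus: this is \<open>x\<close>
        itself if \<open>v\<close> cancels completely, and otherwise a sign of
        \<open>v\<close>.\<close>
      show ?thesis
      proof (cases v' rule: rev_cases)
        case Nil
        have "cancel_step\<^sup>*\<^sup>* (w @ [p]) (u @ [(MinusSign, x), p])"
          using cancel_steps_context[OF vp, of "u @ [(MinusSign, x)]" "[]"] wp Nil by simp
        also have "cancel_step (u @ [(MinusSign, x), p]) u"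
          using cancel_step.intros[of u x z "[]"] p PlusSign by simp
        finally show ?thesis using cancels_to_sign_steps 2(2) by blast
      next
        case (snoc v0 q)
        then obtain y where "q = (MinusSign, y)" using v'(2) by (cases q) auto
        then have "cancel_step (v' @ [p]) v0"
          using cancel_step.intros[of v0 y z "[]"] p PlusSign snoc by simp
        then have "cancel_step\<^sup>*\<^sup>* (v @ [p]) v0" using vp by simp
        moreover have "fst ` set v0 \<subseteq> {MinusSign}" using v'(2) snoc by auto
        ultimately show ?thesis using wp 2(2) unfolding cancels_to_sign_def by blast
      qed
    qed
  qed
qed

text \<open>A minus is deleted only together with a plus to its right, so a final minus survives
  every step.\<close>

lemma not_cancels_to_plus_last_minus: "\<not> cancels_to_sign PlusSign (t @ [(MinusSign, x)])"
proof
  assume "cancels_to_sign PlusSign (t @ [(MinusSign, x)])"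
  then obtain w' where w': "cancel_step\<^sup>*\<^sup>* (t @ [(MinusSign, x)]) w'" "fst ` set w' \<subseteq> {PlusSign}"
    unfolding cancels_to_sign_def by blast
  from w'(1) have "\<exists>t. w' = t @ [(MinusSign, x)]"
  proof induction
    case (step y z)
    then obtain t where t: "y = t @ [(MinusSign, x)]" by blast
    from step.hyps(2) show ?case
    proof cases
      case (1 u a b v)
      then show ?thesis using t by (cases v rule: rev_cases) auto
    qed
  qed simp
  then show False using w'(2) by auto
qed

text \<open>It suffices to look at the last sign of the whole word: a minus there would survive, so
  it is a plus and belongs to \<open>v\<close>.\<close>

lemma plus_after_cancelled_minus:
  assumes "cancels_to_sign PlusSign (u @ (MinusSign, y) # v)"
  shows "\<exists>z. (PlusSign, z) \<in> set v"
proof (cases v rule: rev_cases)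
  case Nil
  then show ?thesis using assms not_cancels_to_plus_last_minus by simp
next
  case (snoc v0 q)
  then have "\<not> cancels_to_sign PlusSign ((u @ (MinusSign, y) # v0) @ [(MinusSign, x)])" for x
    using not_cancels_to_plus_last_minus by blast
  then have "fst q \<noteq> MinusSign" using assms snoc by (cases q) auto
  then have "q = (PlusSign, snd q)" by (cases q; cases "fst q") auto
  then show ?thesis using snoc by (metis in_set_conv_decomp)
qed

lemma good_minus_exists:
  obtains u x v where "t @ [(MinusSign, y)] = u @ (MinusSign, x) # v"
    "cancels_to_sign PlusSign u" "cancels_to_sign MinusSign v"
  using cancels_to_plus_or_good_minus[of "t @ [(MinusSign, y)]"] not_cancels_to_plus_last_minus
  by blast

subsection \<open>Reversing the crystal operators\<close>

lemma ladder_signature_props: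
  assumes "2 \<le> l" "is_partition lam"
  shows "sorted_wrt (\<lambda>p q. ladder_before l (snd p) (snd q)) (ladder_signature l i lam)"
    and "set (ladder_signature l i lam) =
      {PlusSign} \<times> addable l i lam \<union> {MinusSign} \<times> removable l i lam"
  using theI'[OF ladder_signature_ex1[OF assms, of i]] unfolding ladder_signature_def by auto

text \<open>Besides the position itself, addability depends only on the neighbours above and to the
  left, whose residues differ from its own. Removing an \<open>i\<close>-box therefore affects no
  other addable \<open>i\<close>-box.\<close>

lemma addable_remove:
  assumes "2 \<le> l" "is_partition lam" "x \<in> removable l i lam"
  shows "addable l i (lam - {x}) = insert x (addable l i lam)"
proof (rule set_eqI)
  fix p :: box
  obtain a b c d where xp: "x = (a, b)" "p = (c, d)" by (cases x; cases p)
  have x: "x \<in> lam" "is_partition (lam - {x})" "residue l x = i"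
    using assms(3) by (auto simp: removable_def)
  show "p \<in> addable l i (lam - {x}) \<longleftrightarrow> p \<in> insert x (addable l i lam)"
  proof (cases "p = x")
    case True
    then show ?thesis using x assms(2) by (auto simp: addable_def insert_absorb)
  next
    case False
    have "(c - 1, d) \<noteq> x" if "residue l (c, d) = i" "1 \<le> c"
      using that residue_below_neq[OF assms(1), of "c - 1" d] x(3) by auto
    moreover have "(c, d - 1) \<noteq> x" if "residue l (c, d) = i" "1 \<le> d"
      using that residue_right_neq[OF assms(1), of c "d - 1"] x(3) by auto
    ultimately show ?thesis
      using False unfolding xp(2) insert_iff addable_iff[OF assms(2)] addable_iff[OF x(2)]
      by blast
  qed
qed

lemma removable_remove:
  assumes "2 \<le> l" "is_partition lam" "x \<in> removable l i lam"
  shows "removable l i (lam - {x}) = removable l i lam - {x}"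
proof (rule set_eqI)
  fix p :: box
  obtain c d where p: "p = (c, d)" by (cases p)
  have x: "is_partition (lam - {x})" "residue l x = i"
    using assms(3) by (auto simp: removable_def)
  have "(Suc c, d) \<noteq> x" "(c, Suc d) \<noteq> x" if "residue l (c, d) = i"
    using that residue_below_neq[OF assms(1), of c d] residue_right_neq[OF assms(1), of c d] x(2)
    by auto
  then show "p \<in> removable l i (lam - {x}) \<longleftrightarrow> p \<in> removable l i lam - {x}"
    unfolding p Diff_iff removable_iff[OF assms(2)] removable_iff[OF x(1)] by blast
qed

text \<open>Removing \<open>x\<close> only flips its own sign to a plus. After reduction this plus
  stands between pluses and minuses, so it is the rightmost one and \<open>x\<close> is
  cogood.\<close>

lemma f_hat_remove_good:
  assumes "2 \<le> l" "is_partition lam"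
    and w: "ladder_signature l i lam = u @ (MinusSign, x) # v"
    and u: "cancels_to_sign PlusSign u" and v: "cancels_to_sign MinusSign v"
  shows "f_hat l i (lam - {x}) = Some lam"
proof -
  obtain u' v' where u': "cancel_step\<^sup>*\<^sup>* u u'" "fst ` set u' \<subseteq> {PlusSign}"
    and v': "cancel_step\<^sup>*\<^sup>* v v'" "fst ` set v' \<subseteq> {MinusSign}"
    using u v unfolding cancels_to_sign_def by blast
  let ?R = "\<lambda>p q. ladder_before l (snd p) (snd q)"
  note sorted = ladder_signature_props(1)[OF assms(1,2), of i, unfolded w]
  note set = ladder_signature_props(2)[OF assms(1,2), of i, unfolded w]
  have x: "x \<in> removable l i lam" using set by auto
  then have mu: "is_partition (lam - {x})" "x \<in> lam" by (auto simp: removable_def)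
  have "\<not> ladder_before l x x" by (simp add: ladder_before_def)
  then have "(MinusSign, x) \<notin> set u \<union> set v"
    using sorted by (auto simp: sorted_wrt_append)
  then have "set (u @ (PlusSign, x) # v) =
      {PlusSign} \<times> addable l i (lam - {x}) \<union> {MinusSign} \<times> removable l i (lam - {x})"
    unfolding addable_remove[OF assms(1,2) x] removable_remove[OF assms(1,2) x]
    using set by auto
  moreover have "sorted_wrt ?R (u @ (PlusSign, x) # v)"
    using sorted by (simp add: sorted_wrt_append)
  ultimately have sig: "ladder_signature l i (lam - {x}) = u @ (PlusSign, x) # v"
    unfolding ladder_signature_def
    by (intro the1_equality[OF ladder_signature_ex1[OF assms(1) mu(1)]] conjI)
  have "cancel_step\<^sup>*\<^sup>* (u @ (PlusSign, x) # v) (u' @ (PlusSign, x) # v)"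
    using cancel_steps_context[OF u'(1), of "[]"] by simp
  also have "cancel_step\<^sup>*\<^sup>* (u' @ (PlusSign, x) # v) (u' @ (PlusSign, x) # v')"
    using cancel_steps_context[OF v'(1), of "u' @ [(PlusSign, x)]" "[]"] by simp
  finally have "cancel_step\<^sup>*\<^sup>* (ladder_signature l i (lam - {x})) (u' @ (PlusSign, x) # v')"
    unfolding sig .
  moreover have "\<not> cancel_step (u' @ (PlusSign, x) # v') w''" for w''
  proof
    assume "cancel_step (u' @ (PlusSign, x) # v') w''"
    then obtain p a b q where eq: "u' @ (PlusSign, x) # v' = p @ (MinusSign, a) # (PlusSign, b) # q"
      by (blast elim: cancel_step.cases)
    have no_minus: "(MinusSign, c) \<notin> set u'" and no_plus: "(PlusSign, c) \<notin> set v'" for c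
      using u'(2) v'(2) by (auto simp: image_subset_iff)
    from eq consider
        us where "u' = p @ us" "us @ (PlusSign, x) # v' = (MinusSign, a) # (PlusSign, b) # q"
      | us where "p = u' @ us" "(PlusSign, x) # v' = us @ (MinusSign, a) # (PlusSign, b) # q"
      by (auto simp: append_eq_append_conv2)
    then show False
    proof cases
      case (1 us)
      then show False using no_minus[of a] by (cases us) auto
    next
      case (2 us)
      then show False using no_plus[of b] by (cases us) auto
    qed
  qed
  ultimately have "reduces_to (ladder_signature l i (lam - {x})) (u' @ (PlusSign, x) # v')"
    unfolding reduces_to_def by blast
  moreover have "PlusSign \<notin> fst ` set v'" using v'(2) by auto
  ultimately have cogood: "ladder_cogood l i (lam - {x}) x"
    unfolding ladder_cogood_def by blast
  then have ex: "\<exists>y. ladder_cogood l i (lam - {x}) y" by (rule exI)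
  have "(THE y. ladder_cogood l i (lam - {x}) y) = x"
    using cogood by (rule the_equality) (rule ladder_cogood_unique[OF _ cogood])
  then show ?thesis
    unfolding f_hat_def by (simp only: ex if_True insert_Diff[OF mu(2)])
qed

subsection \<open>Partitions without a box of hook length \<open>l * arm\<close>\<close>

text \<open>
  With \<open>(a, f)\<close> the end of its row and \<open>(e, d)\<close> the end of its column, equality of the ladder
  indices means \<open>leg + 1 = (l - 1) * arm\<close> for the box \<open>(a, d)\<close>, that is, \<open>hook = l * arm\<close>.
\<close>

definition ladder_locked :: "nat \<Rightarrow> box set \<Rightarrow> bool" where
  "ladder_locked l lam \<longleftrightarrow>
     (\<forall>a f e d. (a, f) \<in> lam \<longrightarrow> (a, Suc f) \<notin> lam \<longrightarrow> (e, d) \<in> lam \<longrightarrow> (Suc e, d) \<notin> lam \<longrightarrow>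
        d < f \<longrightarrow> ladder_index l (a, f) \<noteq> ladder_index l (Suc e, d))"

lemma ladder_lockedD:
  assumes "ladder_locked l lam" "(a, f) \<in> lam" "(a, Suc f) \<notin> lam"
    "(e, d) \<in> lam" "(Suc e, d) \<notin> lam" "d < f"
  shows "ladder_index l (a, f) \<noteq> ladder_index l (Suc e, d)"
  using assms unfolding ladder_locked_def by blast

lemma ladder_index_eq_imp:
  assumes "ladder_index l (a, f) = ladder_index l (c, d)" "d < f"
  shows "a + (l - 1) * (f - d) = c"
proof -
  have "(l - 1) * f = (l - 1) * (f - d) + (l - 1) * d"
    using assms(2) by (simp add: distrib_left[symmetric])
  then show ?thesis using assms(1) by simp
qed

lemma ladder_index_left_right:
  assumes "ladder_index l (a, f) = ladder_index l (c, d)" "a < c"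
  shows "d < f"
proof (rule ccontr)
  assume "\<not> d < f"
  then have "(l - 1) * f \<le> (l - 1) * d" by (intro mult_le_mono) auto
  then show False using assms unfolding ladder_index.simps by linarith
qed

text \<open>The box \<open>(a, d)\<close> would have arm \<open>k\<close>, leg
  \<open>(l - 1) * k - 1\<close> and hook length \<open>l * k\<close>, violating the
  L-condition.\<close>

lemma L_partition_ladder_locked:
  assumes "3 \<le> l" "L_partition l lam"
  shows "ladder_locked l lam"
  unfolding ladder_locked_def
proof (intro allI impI notI)
  fix a f e d
  assume *: "(a, f) \<in> lam" "(a, Suc f) \<notin> lam" "(e, d) \<in> lam" "(Suc e, d) \<notin> lam" "d < f"
    and idx: "ladder_index l (a, f) = ladder_index l (Suc e, d)"
  have part: "is_partition lam" using assms(2) by (simp add: L_partition_def)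
  define k where "k = f - d"
  have k: "1 \<le> k" using * by (simp add: k_def)
  have e: "a + (l - 1) * k = Suc e"
    using ladder_index_eq_imp[OF idx *(5)] by (simp add: k_def)
  obtain m where l: "l = m + 3" using assms(1) by (metis add.commute le_Suc_ex)
  have arm: "arm lam a d = k"
    using row_length_eq[OF part *(1,2)] by (simp add: arm_def k_def)
  have leg: "leg lam a d + 1 = (l - 1) * k"
    using col_length_eq[OF part *(3,4)] e k l by (auto simp: leg_def)
  have "(a, d) \<in> lam"
    using is_partition_down[OF part *(1), of a d] is_partition_pos[OF part *(1)]
      is_partition_pos[OF part *(3)] *(5) by simp
  moreover have "hook lam a d = l * k"
    using leg l by (simp add: hook_def arm algebra_simps)
  moreover have "arm lam a d < (l - 1) * leg lam a d"
  proof -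
    \<comment> \<open>Here \<open>l >= 3\<close> enters: the leg is at least
      \<open>2 * k - 1\<close>, hence at least \<open>k\<close>.\<close>
    have "k \<le> leg lam a d" using leg k l by (simp add: algebra_simps)
    then have "2 * k \<le> (l - 1) * leg lam a d" using l by (intro mult_le_mono) auto
    then show ?thesis using arm k by linarith
  qed
  moreover have "leg lam a d < (l - 1) * arm lam a d" using leg arm by simp
  ultimately show False using assms(2) unfolding L_partition_def by auto
qed

text \<open>The addable position lies strictly to the left, and the box above it ends column
  \<open>d\<close>, while \<open>(a, b)\<close> ends row \<open>a\<close>. So \<open>(a, d)\<close>
  would have hook length \<open>l * arm\<close>.\<close>

lemma addable_below_removable:
  assumes "is_partition lam" "ladder_locked l lam" "(a, b) \<in> removable l i lam"
    "(c, d) \<in> addable l j lam" "a < c"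
  shows "ladder_index l (a, b) \<noteq> ladder_index l (c, d)"
proof
  assume idx: "ladder_index l (a, b) = ladder_index l (c, d)"
  have "1 \<le> a" using assms(1,3) is_partition_pos by (auto simp: removable_def)
  then have "(c - 1, d) \<in> lam" "Suc (c - 1) = c" "(c, d) \<notin> lam"
    using assms(4,5) by (auto simp: addable_iff[OF assms(1)])
  then show False
    using ladder_lockedD[OF assms(2), of a b "c - 1" d] assms(3) idx
      ladder_index_left_right[OF idx assms(5)]
    by (auto simp: removable_iff[OF assms(1)])
qed

text \<open>Take \<open>i\<close> to be the residue of the last box of \<open>lam\<close> in reading
  order. That box is removable, and no addable box of its residue is read after it.\<close>

lemma ladder_signature_last_minus:
  assumes "2 \<le> l" "is_partition lam" "ladder_locked l lam" "lam \<noteq> {}"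
  shows "\<exists>i t y. i < l \<and> ladder_signature l i lam = t @ [(MinusSign, y)]"
proof -
  let ?idx = "ladder_index l"
  have fin: "finite lam" using assms(2) by (simp add: is_partition_def)
  obtain z where z: "z \<in> lam" "\<And>p. p \<in> lam \<Longrightarrow> \<not> ladder_before l z p"
  proof -
    \<comment> \<open>The order is reversed here, so that a minimal element is the last box.\<close>
    have "acyclic {(p, q). p \<in> lam \<and> q \<in> lam \<and> ladder_before l q p}"
      (is "acyclic ?r")
    proof -
      have "trans ?r" by (auto simp: trans_def ladder_before_def)
      then show ?thesis by (auto simp: acyclic_def ladder_before_def trancl_id)
    qed
    moreover have "finite ?r" by (rule finite_subset[of _ "lam \<times> lam"]) (use fin in auto)
    ultimately have "wf ?r" by (rule finite_acyclic_wf[rotated])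
    moreover obtain z0 where "z0 \<in> lam" using assms(4) by blast
    ultimately obtain z where "z \<in> lam" "\<And>p. (p, z) \<in> ?r \<Longrightarrow> p \<notin> lam"
      by (rule wfE_min) blast
    then show ?thesis using that by blast
  qed
  obtain a b where ab: "z = (a, b)" by (cases z)
  let ?i = "residue l z"
  have z_rem: "(a, b) \<in> removable l ?i lam"
    unfolding removable_iff[OF assms(2)]
    using z(1) z(2)[of "(Suc a, b)"] z(2)[of "(a, Suc b)"] assms(1)
    by (auto simp: ab ladder_before_def)
  have no_add: "\<not> ladder_before l z p" if p: "p \<in> addable l ?i lam" for p
  proof
    assume before: "ladder_before l z p"
    obtain c d where cd: "p = (c, d)" by (cases p)
    have add: "(c, d) \<notin> lam" "1 \<le> c" "1 \<le> d" "residue l (c, d) = ?i"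
      "c = 1 \<or> (c - 1, d) \<in> lam" "d = 1 \<or> (c, d - 1) \<in> lam"
      using p by (auto simp: cd addable_iff[OF assms(2)])
    \<comment> \<open>A later position on the same ladder would lie below \<open>z\<close>, which
      \<open>addable_below_removable\<close> excludes.\<close>
    have "?idx z < ?idx p"
      using before addable_below_removable[OF assms(2,3) z_rem, of c d ?i] p
      by (auto simp: ab cd ladder_before_def)
    then have far: "?idx z + l \<le> ?idx p"
      using residue_eq_less_imp_add_le[of l z p] add(4) assms(1) by (simp add: cd)
    have "(c, d) \<noteq> (1, 1)"
      using add(1) z(1) is_partition_down[OF assms(2), of a b 1 1]
        is_partition_pos[OF assms(2)] ab by auto
    \<comment> \<open>The index of either neighbour is smaller than that of \<open>p\<close> by less
      than \<open>l\<close>, so this box of \<open>lam\<close> would still come after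
      \<open>z\<close>.\<close>
    then consider "(c - 1, d) \<in> lam" | "2 \<le> d" "(c, d - 1) \<in> lam"
      using add by fastforce
    then show False
    proof cases
      case 1
      have "?idx p = ?idx (c - 1, d) + 1" using add(2) by (simp add: cd)
      then show ?thesis using z(2)[OF 1] far assms(1) by (simp add: ladder_before_def)
    next
      case 2
      then obtain d' where d': "d = Suc d'" using add(3) by (cases d) auto
      have "?idx p = ?idx (c, d - 1) + (l - 1)" by (simp add: cd d')
      then have "?idx z < ?idx (c, d - 1)" using far assms(1) by linarith
      then show ?thesis using z(2)[OF 2(2)] by (simp add: ladder_before_def)
    qed
  qed
  note sorted = ladder_signature_props(1)[OF assms(1,2), of ?i]
  note set = ladder_signature_props(2)[OF assms(1,2), of ?i]
  have "(MinusSign, z) \<in> set (ladder_signature l ?i lam)" using set z_rem ab by auto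
  then obtain t v where tv: "ladder_signature l ?i lam = t @ (MinusSign, z) # v"
    by (meson split_list)
  have "v = []"
  proof (rule ccontr)
    assume "v \<noteq> []"
    then obtain s p where p: "(s, p) \<in> set v" by (cases v) auto
    have "\<forall>q \<in> set v. ladder_before l z (snd q)"
      using sorted tv by (simp add: sorted_wrt_append)
    then have "ladder_before l z p" using p by force
    moreover have "(s, p) \<in> set (ladder_signature l ?i lam)" using p tv by simp
    then have "p \<in> addable l ?i lam \<or> p \<in> lam" using set by (auto simp: removable_def)
    ultimately show False using no_add z(2) by blast
  qed
  then show ?thesis using tv residue_less_bound[of l z] assms(1) by auto
qed

text \<open>The assumption \<open>cancelled\<close> is what goodness of \<open>x\<close>
  contributes: every earlier minus is followed by a plus before \<open>x\<close>.\<close>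

lemma ladder_locked_remove_good:
  assumes "2 \<le> l" "is_partition lam" "ladder_locked l lam" "x \<in> removable l i lam"
    and cancelled: "\<And>y. y \<in> removable l i lam \<Longrightarrow> ladder_before l y x \<Longrightarrow>
      \<exists>z \<in> addable l i lam. ladder_before l y z \<and> ladder_before l z x"
  shows "ladder_locked l (lam - {x})"
  unfolding ladder_locked_def
proof (intro allI impI notI)
  let ?idx = "ladder_index l"
  fix r f e d
  assume mem: "(r, f) \<in> lam - {x}" "(e, d) \<in> lam - {x}" and "d < f"
    and ends: "(r, Suc f) \<notin> lam - {x}" "(Suc e, d) \<notin> lam - {x}"
    and idx: "?idx (r, f) = ?idx (Suc e, d)"
  obtain a b where ab: "x = (a, b)" by (cases x)
  have x: "(a, b) \<in> lam" "residue l (a, b) = i" "(Suc a, b) \<notin> lam" "(a, Suc b) \<notin> lam"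
    using assms(4) by (auto simp: ab removable_iff[OF assms(2)])
  note pos = is_partition_pos[OF assms(2)]
  note down = is_partition_down[OF assms(2)]
  have "0 < (l - 1) * (f - d)" using \<open>d < f\<close> assms(1) by simp
  then have "r < Suc e" using ladder_index_eq_imp[OF idx \<open>d < f\<close>] by linarith
  \<comment> \<open>Since \<open>lam\<close> is locked, a forbidden pair must use an end exposed by
    the removal: of the row of \<open>x\<close> or of its column.\<close>
  consider "(r, Suc f) = x" | "(r, Suc f) \<notin> lam" "(Suc e, d) = x"
    using ladder_lockedD[OF assms(3), of r f e d] mem ends idx \<open>d < f\<close> by auto
  then show False
  proof cases
    case 1
    then have [simp]: "a = r" "b = Suc f" using ab by auto
    have "(Suc e, d) \<notin> lam" using ends(2) 1 \<open>d < f\<close> by auto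
    \<comment> \<open>Otherwise \<open>x\<close> and the end \<open>(e, Suc d)\<close> of the next
      column form a forbidden pair in \<open>lam\<close>: both indices grow by
      \<open>l - 1\<close>.\<close>
    moreover have "(e, Suc d) \<notin> lam"
    proof
      assume "(e, Suc d) \<in> lam"
      moreover have "(Suc e, Suc d) \<notin> lam"
        using down[of "Suc e" "Suc d" "Suc e" d] \<open>(Suc e, d) \<notin> lam\<close> pos mem(2) by fastforce
      ultimately show False
        using ladder_lockedD[OF assms(3), of a b e "Suc d"] x idx \<open>d < f\<close> by auto
    qed
    moreover have step: "?idx x = ?idx (e, d) + l"
      using idx assms(1) by (simp add: ab)
    moreover from step have "residue l (e, d) = i"
      using residue_eq_iff[of l x "(e, d)"] x(2) ab assms(1) by auto
    ultimately have y: "(e, d) \<in> removable l i lam"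
      using mem(2) by (simp add: removable_iff[OF assms(2)])
    moreover have "ladder_before l (e, d) x" using step assms(1) by (simp add: ladder_before_def)
    ultimately obtain c g where z: "(c, g) \<in> addable l i lam"
      "ladder_before l (e, d) (c, g)" "ladder_before l (c, g) x"
      using cancelled by (metis surj_pair)
    have z_res: "residue l (c, g) = i" using z(1) by (simp add: addable_def)
    \<comment> \<open>The ladders of \<open>(e, d)\<close> and \<open>x\<close> are exactly
      \<open>l\<close> apart, so no ladder of residue \<open>i\<close> lies strictly between
      them.\<close>
    have "\<not> (?idx (e, d) < ?idx (c, g) \<and> ?idx (c, g) < ?idx x)"
    proof
      assume lt: "?idx (e, d) < ?idx (c, g) \<and> ?idx (c, g) < ?idx x"
      then have "?idx (e, d) + l \<le> ?idx (c, g)"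
        using residue_eq_less_imp_add_le[of l "(e, d)" "(c, g)"] assms(1) z_res y
        by (simp add: removable_def)
      then show False using lt step by linarith
    qed
    then consider "?idx (e, d) = ?idx (c, g)" "e < c" | "?idx (c, g) = ?idx x" "c < a"
      using z(2,3) ab by (auto simp: ladder_before_def)
    then show False
    proof cases
      case 1
      then show ?thesis using addable_below_removable[OF assms(2,3) y z(1)] by blast
    next
      case 2
      have zl: "(c, g) \<notin> lam" "1 \<le> g" "g = 1 \<or> (c, g - 1) \<in> lam"
        using z(1) by (auto simp: addable_iff[OF assms(2)])
      then obtain g' where g: "g = Suc g'" by (cases g) auto
      \<comment> \<open>One column left of the addable box, row \<open>c\<close> ends on the ladder
        of \<open>(Suc e, d)\<close>; hence \<open>(c, d)\<close> already has a forbidden hook in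
        \<open>lam\<close>.\<close>
      have idx': "?idx (c, g') = ?idx (Suc e, d)"
        using 2(1) idx by (simp add: ab g)
      then have "d < g'" using 2(2) \<open>r < Suc e\<close> by (intro ladder_index_left_right[OF idx']) simp
      then show ?thesis
        using ladder_lockedD[OF assms(3), of c g' e d] zl g mem(2) \<open>(Suc e, d) \<notin> lam\<close> idx'
        by auto
    qed
  next
    case 2
    then have [simp]: "a = Suc e" "b = d" using ab by auto
    \<comment> \<open>Otherwise row \<open>Suc r\<close> also ends at column \<open>f\<close>, and
      with the column ending at \<open>x\<close> it forms a forbidden pair: both indices grow by
      1.\<close>
    have "(Suc r, f) \<notin> lam"
    proof
      assume "(Suc r, f) \<in> lam"
      moreover have "(Suc r, Suc f) \<notin> lam"
        using down[of "Suc r" "Suc f" r "Suc f"] 2(1) pos mem(1) by fastforce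
      ultimately show False
        using ladder_lockedD[OF assms(3), of "Suc r" f a b] x idx \<open>d < f\<close> by auto
    qed
    moreover have "residue l (r, f) = i"
      using residue_eq_iff[of l x "(r, f)"] x(2) ab assms(1) idx by auto
    ultimately have y: "(r, f) \<in> removable l i lam"
      using mem(1) 2(1) by (simp add: removable_iff[OF assms(2)])
    moreover have "ladder_before l (r, f) x"
      using idx \<open>r < Suc e\<close> by (simp add: ladder_before_def ab)
    ultimately obtain c g where z: "(c, g) \<in> addable l i lam"
      "ladder_before l (r, f) (c, g)" "ladder_before l (c, g) x"
      using cancelled by (metis surj_pair)
    then have "?idx (r, f) = ?idx (c, g)" "r < c"
      using idx by (auto simp: ladder_before_def ab)
    then show ?thesis using addable_below_removable[OF assms(2,3) y z(1)] by blast
  qed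
qed

text \<open>Induction on the number of boxes: removing the good box keeps the diagram locked, and
  \<open>f_hat\<close> adds that box back.\<close>

lemma ladder_locked_crystal_node:
  assumes "2 \<le> l" "is_partition lam" "ladder_locked l lam"
  shows "lam \<in> crystal_nodes l"
  using assms(2,3)
proof (induction "card lam" arbitrary: lam rule: less_induct)
  case less
  show ?case
  proof (cases "lam = {}")
    case True
    then show ?thesis by (simp add: crystal_nodes.empty)
  next
    case False
    obtain i t y where i: "i < l" "ladder_signature l i lam = t @ [(MinusSign, y)]"
      using ladder_signature_last_minus[OF assms(1) less.prems False] by blast
    obtain u x v where w: "ladder_signature l i lam = u @ (MinusSign, x) # v"
      and u: "cancels_to_sign PlusSign u" and v: "cancels_to_sign MinusSign v"
      unfolding i(2) by (rule good_minus_exists)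
    note sorted = ladder_signature_props(1)[OF assms(1) less.prems(1), of i]
    note set = ladder_signature_props(2)[OF assms(1) less.prems(1), of i]
    have x: "x \<in> removable l i lam" using set w by auto
    have "ladder_locked l (lam - {x})"
    proof (rule ladder_locked_remove_good[OF assms(1) less.prems x])
      fix y assume y: "y \<in> removable l i lam" "ladder_before l y x"
      \<comment> \<open>By sortedness a minus read before \<open>x\<close> lies in \<open>u\<close>.
        As \<open>u\<close> cancels to pluses, a plus follows it inside \<open>u\<close>, hence
        before \<open>x\<close>.\<close>
      have "(MinusSign, y) \<in> set (u @ (MinusSign, x) # v)" using set y(1) w by auto
      moreover have "\<not> ladder_before l x y" "y \<noteq> x" using y(2) by (auto simp: ladder_before_def)
      moreover have "\<forall>q \<in> set v. ladder_before l x (snd q)"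
        using sorted unfolding w by (simp add: sorted_wrt_append)
      ultimately have "(MinusSign, y) \<in> set u" by force
      then obtain u1 u2 where u12: "u = u1 @ (MinusSign, y) # u2" by (meson split_list)
      then obtain z where z: "(PlusSign, z) \<in> set u2"
        using plus_after_cancelled_minus u by blast
      have "\<forall>q \<in> set u2. ladder_before l y (snd q) \<and> ladder_before l (snd q) x"
        using sorted unfolding w u12 by (simp add: sorted_wrt_append)
      then have "ladder_before l y z" "ladder_before l z x" using z by force+
      moreover have "(PlusSign, z) \<in> set (ladder_signature l i lam)" using z w u12 by simp
      then have "z \<in> addable l i lam" using set by auto
      ultimately show "\<exists>z \<in> addable l i lam. ladder_before l y z \<and> ladder_before l z x" by blast
    qed
    moreover have "is_partition (lam - {x})" "x \<in> lam" using x by (auto simp: removable_def)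
    moreover have "card (lam - {x}) < card lam"
      using \<open>x \<in> lam\<close> less.prems(1) by (intro psubset_card_mono) (auto simp: is_partition_def)
    ultimately have "lam - {x} \<in> crystal_nodes l" using less.hyps by blast
    then show ?thesis
      using i(1) f_hat_remove_good[OF assms(1) less.prems(1) w u v]
      by (rule crystal_nodes.step)
  qed
qed

theorem theorem13p4:
  fixes l :: nat and lam :: "box set"
  assumes "l \<ge> 3" and "L_partition l lam"
  shows "lam \<in> crystal_nodes l"
proof (rule ladder_locked_crystal_node)
  show "2 \<le> l" using assms(1) by simp
  show "is_partition lam" using assms(2) by (simp add: L_partition_def)
  show "ladder_locked l lam" using assms by (rule L_partition_ladder_locked)
qed

end
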